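(* The following are true. (1) If $k$ is a non-negative integer, then $$q^{-k^2}C_k(q)=\frac{1}{(q^2;q^2)_{\infty}(q;q^2)_\infty^2}+O(q^{2k+1}).$$ (2) If $k$ is a non-negative integer, then $$\frac{1}{(q^2;q^2)_{\infty}(q;q^2)_\infty^2}=q^{-k^2}\sum_{m=k}^\infty \binom{2m}{m+k}C_{m}(q).$$
   Context: All identities are between formal (Laurent) power series in $q$, and $O(q^N)$ denotes a power series in $q$ all of whose terms have exponent at least $N$. The $q$-Pochhammer symbol is $(a;q)_\infty:=(1-a)(1-aq)(1-aq^2)\cdots$, so $(q^2;q^2)_\infty=\prod_{n\ge1}(1-q^{2n})$ and $(q;q^2)_\infty=\prod_{n\ge1}(1-q^{2n-1})$. For a positive integer $k$, MacMahon's $q$-series is $$C_k(q):=\sum_{0<s_1<s_2<\cdots<s_k}\frac{q^{2s_1+2s_2+\cdots+2s_k-k}}{(1-q^{2s_1-1})^2(1-q^{2s_2-1})^2\cdots(1-q^{2s_k-1})^2},$$ where the sum runs over strictly increasing $k$-tuples of positive integers, and $C_0(q):=1$. *)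

theory Defs
  imports
    "HOL-Analysis.Infinite_Products"
    "HOL-Analysis.Infinite_Sum"
    "HOL-Computational_Algebra.Formal_Laurent_Series"
begin

text \<open>
  All infinite sums and products are limits in the library's \<open>q\<close>-adic metric on
  formal power series.  Every series involved has integer coefficients; we embed these in the
  rationals so that division is available.
\<close>

abbreviation q :: "rat fps" where
  "q \<equiv> fps_X"

definition qpochhammer_inf :: "rat fps \<Rightarrow> rat fps \<Rightarrow> rat fps" where
  "qpochhammer_inf a x = (\<Prod>n. 1 - a * x ^ n)"

text \<open>A tuple \<open>0 < s\<^sub>1 < \<dots> < s\<^sub>k\<close> is represented by the list \<open>[s\<^sub>1, \<dots>, s\<^sub>k]\<close>.\<close>

definition increasing_tuples :: "nat \<Rightarrow> nat list set" where
  "increasing_tuples k =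
     {s. length s = k \<and> sorted_wrt (<) s \<and> (\<forall>i \<in> set s. 0 < i)}"

text \<open>
  Entries of \<open>s\<close> are positive, so neither subtraction on naturals truncates, and the
  denominator has constant coefficient 1.
\<close>

definition MacMahon_C :: "nat \<Rightarrow> rat fps" where
  "MacMahon_C k =
     (\<Sum>\<^sub>\<infinity>s \<in> increasing_tuples k.
        q ^ (2 * sum_list s - k) / (\<Prod>i\<leftarrow>s. (1 - q ^ (2 * i - 1))\<^sup>2))"

lemma MacMahon_C_0: "MacMahon_C 0 = 1"
proof -
  have "increasing_tuples 0 = {[]}"
    by (auto simp: increasing_tuples_def)
  then show ?thesis
    by (simp add: MacMahon_C_def)
qed

text \<open>\<open>q_bigO N\<close> is the set of all power series that \<open>O(q\<^sup>N)\<close> may stand for.\<close>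

definition q_bigO :: "nat \<Rightarrow> rat fps set" where
  "q_bigO N = {f. \<forall>n. fps_nth f n \<noteq> 0 \<longrightarrow> N \<le> n}"

end

theory Submission
  imports Defs
begin

text \<open>
  Let \<open>c\<^sub>m\<close> be \<open>C\<^sub>m\<close> restricted to tuples with entries at most \<open>N\<close>.  Substituting
  \<open>x = (1 + z)\<^sup>2 / z\<close> in \<open>\<Sum>\<^sub>m c\<^sub>m x\<^sup>m = \<Prod>\<^sub>i (1 + x q\<^sup>2\<^sup>i\<^sup>-\<^sup>1 / (1 - q\<^sup>2\<^sup>i\<^sup>-\<^sup>1)\<^sup>2)\<close> turns the factors into
  \<open>(1 + z q\<^sup>2\<^sup>i\<^sup>-\<^sup>1)(1 + z\<^sup>-\<^sup>1 q\<^sup>2\<^sup>i\<^sup>-\<^sup>1) / (1 - q\<^sup>2\<^sup>i\<^sup>-\<^sup>1)\<^sup>2\<close>, the finite form of the Jacobi triple product.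
  Comparing coefficients of \<open>z\<^sup>k\<close> expresses \<open>\<Sum>\<^sub>m binom(2m, m + k) c\<^sub>m\<close> through a central Gaussian
  binomial coefficient in base \<open>q\<^sup>2\<close>; we verify this without \<open>z\<close>, since both sides satisfy the same three-term
  recurrence in \<open>N\<close>.  Letting \<open>N\<close> tend to infinity gives (2), and (1) follows because \<open>q\<close> to the power \<open>m\<^sup>2\<close> divides \<open>C\<^sub>m\<close>.
\<close>

unbundle no vec_syntax

section \<open>Gaussian binomial coefficients\<close>

text \<open>The q-Pascal rule serves as definition because it needs no division, so \<open>p\<close>
  may lie in any commutative ring.\<close>

fun gauss_binomial :: "'a::comm_ring_1 \<Rightarrow> nat \<Rightarrow> nat \<Rightarrow> 'a" where
  "gauss_binomial p n 0 = 1"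
| "gauss_binomial p 0 (Suc k) = 0"
| "gauss_binomial p (Suc n) (Suc k) =
     gauss_binomial p n k + p ^ Suc k * gauss_binomial p n (Suc k)"

lemma gauss_binomial_eq_0: "n < k \<Longrightarrow> gauss_binomial p n k = 0"
  by (induction p n k rule: gauss_binomial.induct) auto

lemma gauss_binomial_same [simp]: "gauss_binomial p n n = 1"
  by (induction n) (auto simp: gauss_binomial_eq_0)

text \<open>The second q-Pascal rule, with the power of \<open>p\<close> on the other term: expand
  by the first rule, apply the induction hypothesis to both terms and regroup.\<close>

lemma gauss_binomial_Suc_Suc':
  "k \<le> n \<Longrightarrow> gauss_binomial p (Suc n) (Suc k) =
     p ^ (n - k) * gauss_binomial p n k + gauss_binomial p n (Suc k)"
proof (induction n arbitrary: k)
  case (Suc n)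
  show ?case
  proof (cases k)
    case 0
    then show ?thesis using Suc.IH[of 0] by (simp add: algebra_simps)
  next
    case (Suc j)
    show ?thesis
    \<comment> \<open>At \<open>j = n\<close> the hypothesis behind \<open>IH2\<close> is out of
      range, but the terms beyond the diagonal vanish.\<close>
    proof (cases "j = n")
      case True
      then show ?thesis using Suc by (simp add: gauss_binomial_eq_0)
    next
      case False
      with Suc Suc.prems have "j < n" by simp
      then have d: "n - j = Suc (n - Suc j)" by simp
      have IH1: "gauss_binomial p (Suc n) (Suc j) =
          p ^ (n - j) * gauss_binomial p n j + gauss_binomial p n (Suc j)"
        by (rule Suc.IH) (use \<open>j < n\<close> in simp)
      have IH2: "gauss_binomial p (Suc n) (Suc (Suc j)) =
          p ^ (n - Suc j) * gauss_binomial p n (Suc j) + gauss_binomial p n (Suc (Suc j))"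
        by (rule Suc.IH) (use \<open>j < n\<close> in simp)
      have "gauss_binomial p (Suc (Suc n)) (Suc k) =
          gauss_binomial p (Suc n) (Suc j) + p ^ Suc (Suc j) * gauss_binomial p (Suc n) (Suc (Suc j))"
        using Suc by simp
      also have "\<dots> = p ^ (n - j) * (gauss_binomial p n j + p ^ Suc j * gauss_binomial p n (Suc j))
          + (gauss_binomial p n (Suc j) + p ^ Suc (Suc j) * gauss_binomial p n (Suc (Suc j)))"
        unfolding IH1 IH2 d by (simp add: algebra_simps)
      finally show ?thesis using Suc by simp
    qed
  qed
qed auto

text \<open>Expanding one side by the first Pascal rule and the other by the second gives sums whose
  terms match by induction.\<close>

lemma gauss_binomial_symmetric:
  "gauss_binomial p (a + b) a = gauss_binomial p (a + b) b"
proof (induction "a + b" arbitrary: a b)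
  case (Suc n)
  show ?case
  proof (cases "a = 0 \<or> b = 0")
    case False
    then obtain c d where cd: "a = Suc c" "b = Suc d"
      by (metis not0_implies_Suc)
    have n: "n = c + Suc d" "n = Suc c + d" using Suc.hyps(2) cd by simp_all
    have s1: "gauss_binomial p n c = gauss_binomial p n (Suc d)"
      using Suc.hyps(1)[OF n(1)] n(1) by simp
    have s2: "gauss_binomial p n (Suc c) = gauss_binomial p n d"
      using Suc.hyps(1)[OF n(2)] n(2) by simp
    have "gauss_binomial p (Suc n) (Suc d) = 
       p ^ (n - d) * gauss_binomial p n d + gauss_binomial p n (Suc d)"
      using n by (intro gauss_binomial_Suc_Suc') simp
    then have "gauss_binomial p (Suc n) (Suc c) = gauss_binomial p (Suc n) (Suc d)"
      using s1 s2 n(2) by simp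
    then show ?thesis using Suc.hyps(2) cd by simp
  qed auto
qed auto

text \<open>The quotient formula with denominators cleared. The induction step rests on (1 - p^a) +
  p^a (1 - p^b) = 1 - p^(a+b).\<close>

lemma gauss_binomial_prod:
  "gauss_binomial p (a + b) a * (\<Prod>i<a. 1 - p ^ Suc i) * (\<Prod>i<b. 1 - p ^ Suc i) =
     (\<Prod>i<a + b. 1 - p ^ Suc i)"
proof (induction "a + b" arbitrary: a b)
  case (Suc n)
  let ?P = "\<lambda>n. \<Prod>i<n. 1 - p ^ Suc i"
  show ?case
  proof (cases "a = 0 \<or> b = 0")
    case False
    then obtain c d where cd: "a = Suc c" "b = Suc d"
      by (metis not0_implies_Suc)
    have n: "n = c + Suc d" "n = Suc c + d" using Suc.hyps(2) cd by simp_all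
    have s1: "gauss_binomial p n c * ?P c * ?P (Suc d) = ?P n"
      using Suc.hyps(1)[OF n(1)] n(1) by simp
    have s2: "gauss_binomial p n (Suc c) * ?P (Suc c) * ?P d = ?P n"
      using Suc.hyps(1)[OF n(2)] n(2) by simp
    have "gauss_binomial p (Suc n) (Suc c) * ?P (Suc c) * ?P (Suc d) =
        (gauss_binomial p n c * ?P c * ?P (Suc d)) * (1 - p ^ Suc c)
        + p ^ Suc c * (1 - p ^ Suc d) * (gauss_binomial p n (Suc c) * ?P (Suc c) * ?P d)"
      by (simp add: algebra_simps)
    also have "\<dots> = ?P n * (1 - p ^ Suc (c + Suc d))"
      unfolding s1 s2 by (simp add: algebra_simps power_add)
    also have "\<dots> = ?P (Suc n)"
      using n by simp
    finally show ?thesis using Suc.hyps(2) cd by simp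
  qed auto
qed auto

text \<open>The first Pascal rule leads from row 2N + 2 to row 2N + 1, the second from there to row
  2N. The bound on \<open>k\<close> keeps \<open>N - k\<close> from truncating.\<close>

lemma gauss_binomial_central_Suc:
  assumes "k \<le> N"
  shows "gauss_binomial p (2 * Suc N) (Suc N + Suc k) =
     p ^ (N - k) * gauss_binomial p (2 * N) (N + k)
     + (1 + p ^ Suc (2 * N)) * gauss_binomial p (2 * N) (N + Suc k)
     + p ^ (N + k + 2) * gauss_binomial p (2 * N) (N + Suc (Suc k))"
proof -
  have a: "gauss_binomial p (Suc (2 * N)) (Suc (N + k)) =
      p ^ (N - k) * gauss_binomial p (2 * N) (N + k) + gauss_binomial p (2 * N) (Suc (N + k))"
    using gauss_binomial_Suc_Suc'[of "N + k" "2 * N" p] assms by (simp add: mult_2)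
  have b: "p ^ (N + k + 2) * gauss_binomial p (Suc (2 * N)) (Suc (Suc (N + k))) =
     p ^ Suc (2 * N) * gauss_binomial p (2 * N) (Suc (N + k))
     + p ^ (N + k + 2) * gauss_binomial p (2 * N) (Suc (Suc (N + k)))"
  \<comment> \<open>For \<open>k = N\<close> the exponent \<open>2 * N - Suc (N + k)\<close> would
    truncate, but every binomial in the equation is zero.\<close>
  proof (cases "k = N")
    case True
    then show ?thesis by (simp add: gauss_binomial_eq_0)
  next
    case False
    have "N + k + 2 + (2 * N - Suc (N + k)) = Suc (2 * N)" using assms False by simp
    then have e: "p ^ (N + k + 2) * p ^ (2 * N - Suc (N + k)) = p ^ Suc (2 * N)"
      by (metis power_add)
    have "gauss_binomial p (Suc (2 * N)) (Suc (Suc (N + k))) =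
      p ^ (2 * N - Suc (N + k)) * gauss_binomial p (2 * N) (Suc (N + k)) +
      gauss_binomial p (2 * N) (Suc (Suc (N + k)))"
      using False assms by (intro gauss_binomial_Suc_Suc') simp
    then show ?thesis
      using e by (simp only: distrib_left mult.assoc[symmetric])
  qed
  have "gauss_binomial p (2 * Suc N) (Suc N + Suc k) =
    gauss_binomial p (Suc (2 * N)) (Suc (N + k))
    + p ^ (N + k + 2) * gauss_binomial p (Suc (2 * N)) (Suc (Suc (N + k)))"
    by simp
  then show ?thesis unfolding a b by (simp add: algebra_simps)
qed

text \<open>Here the neighbours on both sides of the centre agree by symmetry, whence the factor
  2.\<close>

lemma gauss_binomial_central_0:
  "gauss_binomial p (2 * Suc N) (Suc N) =
     (1 + p ^ Suc (2 * N)) * gauss_binomial p (2 * N) N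
     + 2 * p ^ Suc N * gauss_binomial p (2 * N) (Suc N)"
proof -
  have sym: "gauss_binomial p (Suc (2 * N)) N = gauss_binomial p (Suc (2 * N)) (Suc N)"
    using gauss_binomial_symmetric[of p N "Suc N"] by (simp add: mult_2)
  have pascal: "gauss_binomial p (Suc (2 * N)) (Suc N) =
      p ^ N * gauss_binomial p (2 * N) N + gauss_binomial p (2 * N) (Suc N)"
    using gauss_binomial_Suc_Suc'[of N "2 * N" p] by simp
  have e: "p ^ Suc N * p ^ N = p ^ Suc (2 * N)"
    by (simp add: power_add mult_2)
  have "gauss_binomial p (2 * Suc N) (Suc N) =
     gauss_binomial p (Suc (2 * N)) N + p ^ Suc N * gauss_binomial p (Suc (2 * N)) (Suc N)"
    using gauss_binomial.simps(3)[of p "Suc (2 * N)" N] by (simp only: mult_Suc_right add_2_eq_Suc)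
  also have "\<dots> = (gauss_binomial p (2 * N) N + p ^ Suc N * gauss_binomial p (2 * N) (Suc N))
      + p ^ Suc N * (p ^ N * gauss_binomial p (2 * N) N + gauss_binomial p (2 * N) (Suc N))"
    by (simp only: sym gauss_binomial.simps(3)[of p "2 * N" N] pascal[unfolded gauss_binomial.simps(3)])
  also have "\<dots> = (1 + p ^ Suc N * p ^ N) * gauss_binomial p (2 * N) N
      + 2 * p ^ Suc N * gauss_binomial p (2 * N) (Suc N)"
    by (simp only: algebra_simps mult_2 mult_1_left)
  finally show ?thesis unfolding e .
qed

section \<open>Limits of formal power series\<close>

text \<open>Coefficient n of a product involves only the coefficients up to n of the factors, and
  these are eventually constant.\<close>

lemma tendsto_mult_fps:
  fixes f g :: "'b \<Rightarrow> 'a::ring_1 fps"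
  assumes "(f \<longlongrightarrow> a) F" "(g \<longlongrightarrow> b) F"
  shows "((\<lambda>x. f x * g x) \<longlongrightarrow> a * b) F"
proof (rule tendsto_fpsI)
  fix n
  have "\<forall>\<^sub>F x in F. \<forall>i\<in>{..n}. f x $ i = a $ i"
    using assms(1) by (subst eventually_ball_finite_distrib) (auto simp: tendsto_fps_iff)
  moreover have "\<forall>\<^sub>F x in F. \<forall>i\<in>{..n}. g x $ i = b $ i"
    using assms(2) by (subst eventually_ball_finite_distrib) (auto simp: tendsto_fps_iff)
  ultimately show "\<forall>\<^sub>F x in F. (f x * g x) $ n = (a * b) $ n"
    by eventually_elim (auto simp: fps_mult_nth intro!: sum.cong)
qed

lemma fps_nth_eq_0_if_X_power_dvd:
  fixes f :: "'a::comm_ring_1 fps"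
  assumes "fps_X ^ k dvd f" "n < k"
  shows "f $ n = 0"
  using assms by (auto simp: dvd_def fps_X_power_mult_nth)

text \<open>Multiplying by factor n alters only coefficients beyond n, so coefficient j is final
  after j factors; \<open>L\<close> collects these diagonal values.\<close>

lemma has_prod_fps:
  fixes g :: "nat \<Rightarrow> 'a::idom fps"
  assumes g: "\<And>n. fps_X ^ Suc n dvd g n"
  obtains L where "(\<lambda>n. 1 - g n) has_prod L" "L $ 0 = 1"
proof -
  let ?p = "\<lambda>n. \<Prod>i<n. 1 - g i"
  define L where "L = Abs_fps (\<lambda>j. ?p j $ j)"
  have stable: "?p n $ j = ?p j $ j" if "j \<le> n" for n j
    using that
  proof (induction n rule: dec_induct)
    case (step n)
    have "fps_X ^ Suc n dvd ?p n * g n"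
      using g by simp
    then have "(?p n * g n) $ j = 0"
      using step.hyps by (intro fps_nth_eq_0_if_X_power_dvd[of "Suc n"]) auto
    then have "?p (Suc n) $ j = ?p n $ j"
      by (simp add: right_diff_distrib)
    then show ?case using step.IH by simp
  qed simp
  have "?p \<longlonglongrightarrow> L"
    unfolding L_def by (intro tendsto_fpsI eventually_sequentiallyI, subst fps_nth_Abs_fps, rule stable)
  moreover have L0: "L $ 0 = 1"
    by (simp add: L_def)
  ultimately have "raw_has_prod (\<lambda>n. 1 - g n) 0 L"
    by (auto simp: raw_has_prod_def LIMSEQ_lessThan_iff_atMost)
  then show ?thesis
    using that L0 by (auto simp: has_prod_def)
qed

lemma qpochhammer_inf_limit:
  assumes "q dvd a" "q dvd x"
  shows "(\<lambda>N. \<Prod>n<N. 1 - a * x ^ n) \<longlonglongrightarrow> qpochhammer_inf a x"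
    and "qpochhammer_inf a x $ 0 = 1"
proof -
  have "q ^ Suc n dvd a * x ^ n" for n
    using assms by (simp add: mult_dvd_mono dvd_power_same)
  then obtain L where L: "(\<lambda>n. 1 - a * x ^ n) has_prod L" "L $ 0 = 1"
    by (rule has_prod_fps)
  moreover have "qpochhammer_inf a x = L"
    unfolding qpochhammer_inf_def using has_prod_unique[OF L(1)] by simp
  ultimately show "(\<lambda>N. \<Prod>n<N. 1 - a * x ^ n) \<longlonglongrightarrow> qpochhammer_inf a x"
    "qpochhammer_inf a x $ 0 = 1"
    using has_prod_imp_tendsto' by auto
qed

section \<open>Truncated MacMahon series\<close>

definition bounded_tuples :: "nat \<Rightarrow> nat \<Rightarrow> nat list set" where
  "bounded_tuples m N = {s \<in> increasing_tuples m. set s \<subseteq> {..N}}"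

lemma finite_bounded_tuples: "finite (bounded_tuples m N)"
proof (rule finite_subset)
  show "bounded_tuples m N \<subseteq> {s. set s \<subseteq> {..N} \<and> length s = m}"
    by (auto simp: bounded_tuples_def increasing_tuples_def)
qed (simp add: finite_lists_length_eq)

lemma bounded_tuples_0: "bounded_tuples 0 N = {[]}"
  by (auto simp: bounded_tuples_def increasing_tuples_def)

lemma bounded_tuples_Suc_0: "bounded_tuples (Suc m) 0 = {}"
  by (fastforce simp: bounded_tuples_def increasing_tuples_def length_Suc_conv)

text \<open>In an increasing tuple the new bound can occur only as the last entry.\<close>

lemma bounded_tuples_Suc_Suc:
  "bounded_tuples (Suc m) (Suc N) =
     bounded_tuples (Suc m) N \<union> (\<lambda>s. s @ [Suc N]) ` bounded_tuples m N"
proof (intro subset_antisym subsetI)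
  fix s assume s: "s \<in> bounded_tuples (Suc m) (Suc N)"
  then have "s \<noteq> []" by (auto simp: bounded_tuples_def increasing_tuples_def)
  then obtain t i where t: "s = t @ [i]" by (metis rev_exhaust)
  show "s \<in> bounded_tuples (Suc m) N \<union> (\<lambda>s. s @ [Suc N]) ` bounded_tuples m N"
  proof (cases "i = Suc N")
    case True
    then have "t \<in> bounded_tuples m N"
      using s t by (fastforce simp: bounded_tuples_def increasing_tuples_def sorted_wrt_append)
    then show ?thesis using t True by auto
  next
    case False
    then have "s \<in> bounded_tuples (Suc m) N"
      using s t by (fastforce simp: bounded_tuples_def increasing_tuples_def sorted_wrt_append)
    then show ?thesis by simp
  qed
next
  fix s assume "s \<in> bounded_tuples (Suc m) N \<union> (\<lambda>s. s @ [Suc N]) ` bounded_tuples m N"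
  then show "s \<in> bounded_tuples (Suc m) (Suc N)"
    by (fastforce simp: bounded_tuples_def increasing_tuples_def sorted_wrt_append)
qed

text \<open>The share of a single entry in a MacMahon summand: the exponent 2(s_1 + ... + s_k) - k
  splits into the odd numbers 2s_i - 1.\<close>

definition macmahon_factor :: "nat \<Rightarrow> rat fps" where
  "macmahon_factor i = q ^ (2 * i - 1) / (1 - q ^ (2 * i - 1))\<^sup>2"

text \<open>This is the elementary symmetric polynomial of degree \<open>m\<close> in the factors
  with indices 1 to \<open>N\<close>.\<close>

definition truncated_C :: "nat \<Rightarrow> nat \<Rightarrow> rat fps" where
  "truncated_C m N = (\<Sum>s \<in> bounded_tuples m N. \<Prod>i\<leftarrow>s. macmahon_factor i)"

lemma truncated_C_0 [simp]: "truncated_C 0 N = 1"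
  by (simp add: truncated_C_def bounded_tuples_0)

lemma truncated_C_Suc_0 [simp]: "truncated_C (Suc m) 0 = 0"
  by (simp add: truncated_C_def bounded_tuples_Suc_0)

lemma truncated_C_Suc_Suc:
  "truncated_C (Suc m) (Suc N) =
     truncated_C (Suc m) N + macmahon_factor (Suc N) * truncated_C m N"
proof -
  have "bounded_tuples (Suc m) N \<inter> (\<lambda>s. s @ [Suc N]) ` bounded_tuples m N = {}"
    by (auto simp: bounded_tuples_def)
  then have "truncated_C (Suc m) (Suc N) = truncated_C (Suc m) N
      + (\<Sum>s \<in> (\<lambda>s. s @ [Suc N]) ` bounded_tuples m N. \<Prod>i\<leftarrow>s. macmahon_factor i)"
    unfolding truncated_C_def bounded_tuples_Suc_Suc
    by (intro sum.union_disjoint) (auto simp: finite_bounded_tuples)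
  also have "(\<Sum>s \<in> (\<lambda>s. s @ [Suc N]) ` bounded_tuples m N. \<Prod>i\<leftarrow>s. macmahon_factor i) =
      macmahon_factor (Suc N) * truncated_C m N"
    by (subst sum.reindex) (auto simp: inj_on_def truncated_C_def sum_distrib_left mult.commute)
  finally show ?thesis .
qed

lemma truncated_C_eq_0: "N < m \<Longrightarrow> truncated_C m N = 0"
proof (induction N arbitrary: m)
  case 0
  then show ?case by (cases m) auto
next
  case (Suc N)
  then show ?case by (cases m) (auto simp: truncated_C_Suc_Suc)
qed

section \<open>Single factors and divisibility by powers of q\<close>

lemma macmahon_factor_eq:
  "i > 0 \<Longrightarrow> macmahon_factor i = q ^ (2 * i - 1) * inverse ((1 - q ^ (2 * i - 1))\<^sup>2)"
  unfolding macmahon_factor_def by (rule fps_divide_unit) (simp add: fps_power_nth)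

lemma macmahon_factor_mult:
  assumes "i > 0"
  shows "(1 - q ^ (2 * i - 1))\<^sup>2 * macmahon_factor i = q ^ (2 * i - 1)"
proof -
  have "inverse ((1 - q ^ (2 * i - 1))\<^sup>2) * (1 - q ^ (2 * i - 1))\<^sup>2 = 1"
    using assms by (intro inverse_mult_eq_1) (simp add: fps_power_nth)
  then show ?thesis
    unfolding macmahon_factor_eq[OF assms] by (simp add: mult_ac)
qed

lemma X_power_dvd_macmahon_factor: "i > 0 \<Longrightarrow> q ^ (2 * i - 1) dvd macmahon_factor i"
  by (simp add: macmahon_factor_eq)

text \<open>The least exponent of a tuple with m entries is 1 + 3 + ... + (2m - 1) = m^2.\<close>

lemma X_power_dvd_truncated_C: "q ^ m\<^sup>2 dvd truncated_C m N"
proof (induction N arbitrary: m)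
  case 0
  show ?case by (cases m) auto
next
  case (Suc N)
  show ?case
  proof (cases m)
    case (Suc j)
    have "q ^ (Suc j)\<^sup>2 dvd macmahon_factor (Suc N) * truncated_C j N"
    \<comment> \<open>If \<open>j\<close> is at most \<open>N\<close>, the new factor supplies 2N +
      1, at least the gap 2j + 1 between consecutive squares; otherwise there are no tuples.\<close>
    proof (cases "j \<le> N")
      case True
      then have "(Suc j)\<^sup>2 \<le> (2 * Suc N - 1) + j\<^sup>2"
        by (simp add: power2_eq_square)
      then have "q ^ (Suc j)\<^sup>2 dvd q ^ (2 * Suc N - 1) * q ^ j\<^sup>2"
        unfolding power_add[symmetric] by (rule le_imp_power_dvd)
      also have "\<dots> dvd macmahon_factor (Suc N) * truncated_C j N"
        by (intro mult_dvd_mono X_power_dvd_macmahon_factor Suc.IH) simp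
      finally show ?thesis .
    qed (simp add: truncated_C_eq_0)
    then show ?thesis using Suc Suc.IH[of "Suc j"] by (simp add: truncated_C_Suc_Suc)
  qed auto
qed

section \<open>From truncated to full MacMahon series\<close>

lemma MacMahon_C_summand:
  assumes "s \<in> increasing_tuples m"
  shows "q ^ (2 * sum_list s - m) / (\<Prod>i\<leftarrow>s. (1 - q ^ (2 * i - 1))\<^sup>2) =
     (\<Prod>i\<leftarrow>s. macmahon_factor i)"
proof -
  \<comment> \<open>The induction also carries the length bound, which rules out truncation in the
    exponent, and the constant coefficient 1, which makes the denominator nonzero for the final
    cancellation.\<close>
  have "length s \<le> 2 * sum_list s \<and> (\<Prod>i\<leftarrow>s. (1 - q ^ (2 * i - 1))\<^sup>2) $ 0 = 1 \<and>
     q ^ (2 * sum_list s - length s) = (\<Prod>i\<leftarrow>s. (1 - q ^ (2 * i - 1))\<^sup>2) * (\<Prod>i\<leftarrow>s. macmahon_factor i)"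
    if "\<forall>i\<in>set s. 0 < i" for s
    using that
  proof (induction s)
    case (Cons i s)
    let ?D = "\<lambda>s. \<Prod>i\<leftarrow>s. (1 - q ^ (2 * i - 1))\<^sup>2"
    have i: "i > 0" and IH: "length s \<le> 2 * sum_list s" "?D s $ 0 = 1"
      "q ^ (2 * sum_list s - length s) = ?D s * (\<Prod>i\<leftarrow>s. macmahon_factor i)"
      using Cons by auto
    have e: "2 * sum_list (i # s) - length (i # s) = (2 * i - 1) + (2 * sum_list s - length s)"
      using i IH(1) by simp
    have "q ^ (2 * sum_list (i # s) - length (i # s)) =
        (1 - q ^ (2 * i - 1))\<^sup>2 * macmahon_factor i * (?D s * (\<Prod>i\<leftarrow>s. macmahon_factor i))"
      unfolding e power_add IH(3) macmahon_factor_mult[OF i] ..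
    then show ?case using i IH(1,2) by (simp add: mult_ac fps_power_nth)
  qed simp
  moreover have "length s = m" "\<forall>i\<in>set s. 0 < i"
    using assms by (auto simp: increasing_tuples_def)
  ultimately have *: "(\<Prod>i\<leftarrow>s. (1 - q ^ (2 * i - 1))\<^sup>2) $ 0 = 1"
     "q ^ (2 * sum_list s - m) = (\<Prod>i\<leftarrow>s. (1 - q ^ (2 * i - 1))\<^sup>2) * (\<Prod>i\<leftarrow>s. macmahon_factor i)"
    by blast+
  then have "(\<Prod>i\<leftarrow>s. (1 - q ^ (2 * i - 1))\<^sup>2) \<noteq> 0" by auto
  then show ?thesis unfolding *(2) by simp
qed

text \<open>An entry i > n makes the summand a multiple of q^(2i-1) with 2i - 1 > n, so only tuples
  bounded by n reach coefficient n.\<close>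

lemma MacMahon_C_nth:
  assumes "n \<le> N"
  shows "MacMahon_C m $ n = truncated_C m N $ n"
proof -
  let ?w = "\<lambda>s. \<Prod>i\<leftarrow>s. macmahon_factor i"
  have vanish: "s \<in> bounded_tuples m n" if "s \<in> increasing_tuples m" "?w s $ n \<noteq> 0" for s n
  proof -
    have "i \<le> n" if "i \<in> set s" for i
    proof (rule ccontr)
      assume "\<not> i \<le> n"
      have "q ^ (2 * i - 1) dvd macmahon_factor i"
        using \<open>\<not> i \<le> n\<close> by (intro X_power_dvd_macmahon_factor) simp
      also have "\<dots> dvd ?w s"
        using that by (intro prod_list_dvd) auto
      finally show False
        using \<open>?w s $ n \<noteq> 0\<close> \<open>\<not> i \<le> n\<close> fps_nth_eq_0_if_X_power_dvd[of "2 * i - 1" "?w s" n] by simp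
    qed
    then show ?thesis using that by (auto simp: bounded_tuples_def)
  qed
  have fin: "finite {s \<in> increasing_tuples m. ?w s $ n \<noteq> 0}" for n
    by (rule finite_subset[OF _ finite_bounded_tuples[of m n]]) (use vanish in auto)
  have "MacMahon_C m = (\<Sum>\<^sub>\<infinity>s \<in> increasing_tuples m. ?w s)"
    unfolding MacMahon_C_def by (intro infsum_cong) (rule MacMahon_C_summand)
  \<comment> \<open>Each coefficient receives finitely many nonzero contributions, so the q-adic sum
    is formed coefficientwise.\<close>
  also have "\<dots> = Abs_fps (\<lambda>n. \<Sum>s | s \<in> increasing_tuples m \<and> ?w s $ n \<noteq> 0. ?w s $ n)"
    by (intro infsumI has_sum_fpsI fin) simp
  finally have "MacMahon_C m $ n = (\<Sum>s | s \<in> increasing_tuples m \<and> ?w s $ n \<noteq> 0. ?w s $ n)"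
    by simp
  also have "\<dots> = (\<Sum>s \<in> bounded_tuples m N. ?w s $ n)"
  proof (rule sum.mono_neutral_left)
    show "{s. s \<in> increasing_tuples m \<and> ?w s $ n \<noteq> 0} \<subseteq> bounded_tuples m N"
      using vanish assms by (fastforce simp: bounded_tuples_def)
  qed (auto simp: finite_bounded_tuples, auto simp: bounded_tuples_def)
  finally show ?thesis by (simp add: truncated_C_def fps_sum_nth)
qed

lemma MacMahon_C_nth_eq_0: "n < m\<^sup>2 \<Longrightarrow> MacMahon_C m $ n = 0"
  using fps_nth_eq_0_if_X_power_dvd[OF X_power_dvd_truncated_C] MacMahon_C_nth[of n n m] by auto

section \<open>The finite identity\<close>

text \<open>The coefficient of z^k in the sum of c_m ((1 + z)^2 / z)^m, because binom(2m, m + k) is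
  the coefficient of z^k in (1 + z)^(2m) / z^m.\<close>

definition binomial_transform :: "nat \<Rightarrow> nat \<Rightarrow> rat fps" where
  "binomial_transform N k = (\<Sum>m\<le>N. of_nat ((2 * m) choose (m + k)) * truncated_C m N)"

lemma binomial_transform_Suc:
  "binomial_transform (Suc N) k = binomial_transform N k
     + macmahon_factor (Suc N) *
       (\<Sum>m\<le>N. of_nat ((2 * Suc m) choose (Suc m + k)) * truncated_C m N)"
proof -
  let ?b = "\<lambda>m. of_nat ((2 * m) choose (m + k)) :: rat fps"
  have "binomial_transform (Suc N) k = ?b 0 + (\<Sum>m\<le>N. ?b (Suc m) * truncated_C (Suc m) (Suc N))"
    unfolding binomial_transform_def by (subst sum.atMost_Suc_shift) simp
  also have "(\<Sum>m\<le>N. ?b (Suc m) * truncated_C (Suc m) (Suc N)) =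
      (\<Sum>m\<le>N. ?b (Suc m) * truncated_C (Suc m) N)
      + macmahon_factor (Suc N) * (\<Sum>m\<le>N. ?b (Suc m) * truncated_C m N)"
    unfolding truncated_C_Suc_Suc
    by (simp add: distrib_left sum.distrib sum_distrib_left mult_ac)
  also have "?b 0 + ((\<Sum>m\<le>N. ?b (Suc m) * truncated_C (Suc m) N)
      + macmahon_factor (Suc N) * (\<Sum>m\<le>N. ?b (Suc m) * truncated_C m N)) =
      (?b 0 * truncated_C 0 N + (\<Sum>m\<le>N. ?b (Suc m) * truncated_C (Suc m) N))
      + macmahon_factor (Suc N) * (\<Sum>m\<le>N. ?b (Suc m) * truncated_C m N)"
    by simp
  also have "?b 0 * truncated_C 0 N + (\<Sum>m\<le>N. ?b (Suc m) * truncated_C (Suc m) N) =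
      (\<Sum>m\<le>Suc N. ?b m * truncated_C m N)"
    by (rule sum.atMost_Suc_shift[symmetric])
  \<comment> \<open>The extra term \<open>m = Suc N\<close> vanishes, since no tuple of that length
    has entries at most \<open>N\<close>.\<close>
  also have "\<dots> = binomial_transform N k"
    by (simp add: binomial_transform_def truncated_C_eq_0)
  finally show ?thesis .
qed

text \<open>Pascal's rule twice; on generating functions, multiplication by (1 + z)^2 / z = 1/z + 2
  + z.\<close>

lemma choose_central_Suc:
  "(2 * Suc m) choose (Suc m + Suc k) =
     (2 * m choose (m + k)) + 2 * (2 * m choose (m + Suc k)) + (2 * m choose (m + Suc (Suc k)))"
  by simp

text \<open>At the centre the term for k = -1 equals the one for k = 1 by symmetry.\<close>

lemma choose_central_0:
  "(2 * Suc m) choose (Suc m + 0) = 2 * (2 * m choose (m + 0)) + 2 * (2 * m choose (m + Suc 0))"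
proof -
  have "Suc (2 * m) choose m = Suc (2 * m) choose Suc m"
    using binomial_symmetric[of m "Suc (2 * m)"] by simp
  then have "(2 * Suc m) choose Suc m = 2 * (Suc (2 * m) choose Suc m)"
    by simp
  then show ?thesis by simp
qed

text \<open>Multiplying by (1 - Q)^2 clears the denominator of the new factor, and (1 - Q)^2 + 2Q =
  1 + Q^2.\<close>

lemma binomial_transform_Suc_Suc:
  fixes N :: nat
  defines "Q \<equiv> q ^ (2 * N + 1)"
  shows "(1 - Q)\<^sup>2 * binomial_transform (Suc N) (Suc k) =
     (1 + Q\<^sup>2) * binomial_transform N (Suc k)
     + Q * (binomial_transform N k + binomial_transform N (Suc (Suc k)))"
proof -
  have y: "(1 - Q)\<^sup>2 * macmahon_factor (Suc N) = Q"
    using macmahon_factor_mult[of "Suc N"] by (simp add: Q_def)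
  have "(1 - Q)\<^sup>2 * binomial_transform (Suc N) (Suc k) =
     (1 - Q)\<^sup>2 * binomial_transform N (Suc k) + ((1 - Q)\<^sup>2 * macmahon_factor (Suc N)) *
      (binomial_transform N k + 2 * binomial_transform N (Suc k) + binomial_transform N (Suc (Suc k)))"
    unfolding binomial_transform_Suc choose_central_Suc
    by (simp add: binomial_transform_def algebra_simps sum.distrib sum_distrib_left)
  then show ?thesis unfolding y by (simp add: power2_eq_square algebra_simps)
qed

lemma binomial_transform_Suc_0:
  fixes N :: nat
  defines "Q \<equiv> q ^ (2 * N + 1)"
  shows "(1 - Q)\<^sup>2 * binomial_transform (Suc N) 0 =
     (1 + Q\<^sup>2) * binomial_transform N 0 + 2 * Q * binomial_transform N (Suc 0)"
proof -
  have y: "(1 - Q)\<^sup>2 * macmahon_factor (Suc N) = Q"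
    using macmahon_factor_mult[of "Suc N"] by (simp add: Q_def)
  have "(1 - Q)\<^sup>2 * binomial_transform (Suc N) 0 =
     (1 - Q)\<^sup>2 * binomial_transform N 0 + ((1 - Q)\<^sup>2 * macmahon_factor (Suc N)) *
      (2 * binomial_transform N 0 + 2 * binomial_transform N (Suc 0))"
    unfolding binomial_transform_Suc choose_central_0
    by (simp add: binomial_transform_def algebra_simps sum.distrib sum_distrib_left)
  then show ?thesis unfolding y by (simp add: power2_eq_square algebra_simps)
qed

text \<open>The weight x^(k^2) turns the uneven powers of x^2 in the central recurrence into the
  common coefficient \<open>Q\<close>, which yields the recurrence of the binomial transform. For
  \<open>k > N\<close> everything vanishes.\<close>

lemma weighted_gauss_binomial_Suc_Suc:
  fixes N :: nat and x :: "'a::comm_ring_1"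
  defines "Q \<equiv> x ^ (2 * N + 1)"
    and "G \<equiv> \<lambda>N k. x ^ k\<^sup>2 * gauss_binomial (x\<^sup>2) (2 * N) (N + k)"
  shows "G (Suc N) (Suc k) = (1 + Q\<^sup>2) * G N (Suc k) + Q * (G N k + G N (Suc (Suc k)))"
proof (cases "k \<le> N")
  case True
  have e1: "x ^ (Suc k)\<^sup>2 * (x\<^sup>2) ^ (N - k) = Q * x ^ k\<^sup>2"
  proof -
    have "(Suc k)\<^sup>2 + 2 * (N - k) = (2 * N + 1) + k\<^sup>2"
      using True by (simp add: power2_eq_square)
    then show ?thesis unfolding Q_def by (metis power_add power_mult)
  qed
  have e2: "(x\<^sup>2) ^ Suc (2 * N) = Q\<^sup>2"
    unfolding Q_def power_mult[symmetric] by (simp add: mult.commute)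
  have e3: "x ^ (Suc k)\<^sup>2 * (x\<^sup>2) ^ (N + k + 2) = Q * x ^ (Suc (Suc k))\<^sup>2"
  proof -
    have "(Suc k)\<^sup>2 + 2 * (N + k + 2) = (2 * N + 1) + (Suc (Suc k))\<^sup>2"
      by (simp add: power2_eq_square)
    then show ?thesis unfolding Q_def by (metis power_add power_mult)
  qed
  have "G (Suc N) (Suc k) =
      (x ^ (Suc k)\<^sup>2 * (x\<^sup>2) ^ (N - k)) * gauss_binomial (x\<^sup>2) (2 * N) (N + k)
      + (1 + (x\<^sup>2) ^ Suc (2 * N)) * (x ^ (Suc k)\<^sup>2 * gauss_binomial (x\<^sup>2) (2 * N) (N + Suc k))
      + (x ^ (Suc k)\<^sup>2 * (x\<^sup>2) ^ (N + k + 2)) * gauss_binomial (x\<^sup>2) (2 * N) (N + Suc (Suc k))"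
    unfolding G_def gauss_binomial_central_Suc[OF True] by (simp only: algebra_simps)
  then show ?thesis
    unfolding e1 e2 e3 G_def by (simp only: algebra_simps)
qed (simp add: G_def gauss_binomial_eq_0)

lemma weighted_gauss_binomial_Suc_0:
  fixes N :: nat and x :: "'a::comm_ring_1"
  defines "Q \<equiv> x ^ (2 * N + 1)"
    and "G \<equiv> \<lambda>N k. x ^ k\<^sup>2 * gauss_binomial (x\<^sup>2) (2 * N) (N + k)"
  shows "G (Suc N) 0 = (1 + Q\<^sup>2) * G N 0 + 2 * Q * G N (Suc 0)"
proof -
  have e1: "(x\<^sup>2) ^ Suc (2 * N) = Q\<^sup>2"
    unfolding Q_def power_mult[symmetric] by (simp add: mult.commute)
  have e2: "(x\<^sup>2) ^ Suc N = Q * x"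
    unfolding Q_def power_mult[symmetric] by (simp add: mult_ac)
  have "G (Suc N) 0 = (1 + (x\<^sup>2) ^ Suc (2 * N)) * gauss_binomial (x\<^sup>2) (2 * N) N
      + 2 * (x\<^sup>2) ^ Suc N * gauss_binomial (x\<^sup>2) (2 * N) (Suc N)"
    unfolding G_def using gauss_binomial_central_0[of "x\<^sup>2" N] by simp
  then show ?thesis unfolding e1 e2 G_def by (simp add: algebra_simps)
qed

text \<open>The z^k coefficient of the finite Jacobi triple product. Both sides obey the same
  recurrence in \<open>N\<close>, and for \<open>N = 0\<close> both are 1 at \<open>k = 0\<close>
  and 0 elsewhere.\<close>

lemma binomial_transform_eq_gauss_binomial:
  "binomial_transform N k * (\<Prod>i<N. 1 - q ^ (2 * i + 1))\<^sup>2 =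
     q ^ k\<^sup>2 * gauss_binomial (q\<^sup>2) (2 * N) (N + k)"
proof (induction N arbitrary: k)
  case 0
  show ?case by (cases k) (auto simp: binomial_transform_def)
next
  case (Suc N)
  define Q where "Q = q ^ (2 * N + 1)"
  define D where "D = (\<Prod>i<N. 1 - q ^ (2 * i + 1))"
  have IH: "binomial_transform N k * D\<^sup>2 = q ^ k\<^sup>2 * gauss_binomial (q\<^sup>2) (2 * N) (N + k)" for k
    using Suc.IH by (simp add: D_def)
  have *: "binomial_transform (Suc N) k * (\<Prod>i<Suc N. 1 - q ^ (2 * i + 1))\<^sup>2 =
      ((1 - Q)\<^sup>2 * binomial_transform (Suc N) k) * D\<^sup>2" for k
    by (simp add: Q_def D_def power_mult_distrib mult_ac)
  show ?case
  proof (cases k)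
    case 0
    have "((1 - Q)\<^sup>2 * binomial_transform (Suc N) 0) * D\<^sup>2 =
        (1 + Q\<^sup>2) * (binomial_transform N 0 * D\<^sup>2) + 2 * Q * (binomial_transform N (Suc 0) * D\<^sup>2)"
      unfolding Q_def binomial_transform_Suc_0 by (simp only: algebra_simps)
    also have "\<dots> = q ^ 0\<^sup>2 * gauss_binomial (q\<^sup>2) (2 * Suc N) (Suc N + 0)"
      unfolding IH Q_def by (rule weighted_gauss_binomial_Suc_0[symmetric])
    finally show ?thesis unfolding * 0 .
  next
    case (Suc j)
    have "((1 - Q)\<^sup>2 * binomial_transform (Suc N) (Suc j)) * D\<^sup>2 =
        (1 + Q\<^sup>2) * (binomial_transform N (Suc j) * D\<^sup>2)
        + Q * (binomial_transform N j * D\<^sup>2 + binomial_transform N (Suc (Suc j)) * D\<^sup>2)"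
      unfolding Q_def binomial_transform_Suc_Suc by (simp only: algebra_simps)
    also have "\<dots> = q ^ (Suc j)\<^sup>2 * gauss_binomial (q\<^sup>2) (2 * Suc N) (Suc N + Suc j)"
      unfolding IH Q_def by (rule weighted_gauss_binomial_Suc_Suc[symmetric])
    finally show ?thesis unfolding * Suc .
  qed
qed

section \<open>Passage to the limit\<close>

lemma binomial_sum_MacMahon_C_nth:
  assumes "n \<le> N"
  shows "(\<Sum>\<^sub>\<infinity>m \<in> {k..}. of_nat ((2 * m) choose (m + k)) * MacMahon_C m) $ n =
     (\<Sum>m = k..N. of_nat ((2 * m) choose (m + k)) * MacMahon_C m $ n)"
proof -
  let ?f = "\<lambda>m. of_nat ((2 * m) choose (m + k)) * MacMahon_C m"
  have nth: "?f m $ n = of_nat ((2 * m) choose (m + k)) * MacMahon_C m $ n" for m n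
    by (simp add: fps_of_nat[symmetric] del: fps_of_nat)
  \<comment> \<open>The series C_m begins no earlier than q^(m^2), and m^2 is at least m.\<close>
  have vanish: "?f m $ n = 0" if "n < m" for m n
    unfolding nth using that power2_nat_le_eq_le[of m] self_le_power[of m 2]
    by (subst MacMahon_C_nth_eq_0) auto
  have fin: "finite {m \<in> {k..}. ?f m $ n \<noteq> 0}" for n
    by (rule finite_subset[of _ "{..n}"]) (use vanish in \<open>auto simp: not_le[symmetric]\<close>)
  have "(\<Sum>\<^sub>\<infinity>m \<in> {k..}. ?f m) = Abs_fps (\<lambda>n. \<Sum>m | m \<in> {k..} \<and> ?f m $ n \<noteq> 0. ?f m $ n)"
    by (intro infsumI has_sum_fpsI fin) simp
  then have "(\<Sum>\<^sub>\<infinity>m \<in> {k..}. ?f m) $ n = (\<Sum>m | m \<in> {k..} \<and> ?f m $ n \<noteq> 0. ?f m $ n)"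
    by simp
  also have "\<dots> = (\<Sum>m = k..N. ?f m $ n)"
  proof (rule sum.mono_neutral_left)
    show "{m. m \<in> {k..} \<and> ?f m $ n \<noteq> 0} \<subseteq> {k..N}"
      using vanish[of n] assms by (force simp: not_le[symmetric])
  qed auto
  finally show ?thesis by (simp add: nth)
qed

text \<open>From N = n on, coefficient n no longer changes; the terms with m < k drop out because
  their binomials are zero.\<close>

lemma binomial_transform_limit:
  "(\<lambda>N. binomial_transform N k) \<longlonglongrightarrow>
     (\<Sum>\<^sub>\<infinity>m \<in> {k..}. of_nat ((2 * m) choose (m + k)) * MacMahon_C m)"
proof (rule tendsto_fpsI)
  fix n
  have "binomial_transform N k $ n =
      (\<Sum>\<^sub>\<infinity>m \<in> {k..}. of_nat ((2 * m) choose (m + k)) * MacMahon_C m) $ n" if "n \<le> N" for N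
  proof -
    have "binomial_transform N k $ n = (\<Sum>m\<le>N. of_nat ((2 * m) choose (m + k)) * MacMahon_C m $ n)"
      using that
      by (simp add: binomial_transform_def fps_sum_nth MacMahon_C_nth fps_of_nat[symmetric] del: fps_of_nat)
    also have "\<dots> = (\<Sum>m = k..N. of_nat ((2 * m) choose (m + k)) * MacMahon_C m $ n)"
      by (rule sum.mono_neutral_right) (auto simp: binomial_eq_0)
    finally show ?thesis using binomial_sum_MacMahon_C_nth[OF that] by simp
  qed
  then show "\<forall>\<^sub>F N in sequentially. binomial_transform N k $ n =
      (\<Sum>\<^sub>\<infinity>m \<in> {k..}. of_nat ((2 * m) choose (m + k)) * MacMahon_C m) $ n"
    unfolding eventually_sequentially by blast
qed

text \<open>Writing the Gaussian binomial as a quotient of products and letting N grow gives S R^2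
  E^2 = q^(k^2) E; one factor \<open>E\<close>, with constant coefficient 1, cancels.\<close>

lemma binomial_sum_MacMahon_C:
  "(\<Sum>\<^sub>\<infinity>m \<in> {k..}. of_nat ((2 * m) choose (m + k)) * MacMahon_C m) *
     (qpochhammer_inf (q\<^sup>2) (q\<^sup>2) * (qpochhammer_inf q (q\<^sup>2))\<^sup>2) = q ^ k\<^sup>2"
proof -
  define S where "S = (\<Sum>\<^sub>\<infinity>m \<in> {k..}. of_nat ((2 * m) choose (m + k)) * MacMahon_C m)"
  define E where "E = qpochhammer_inf (q\<^sup>2) (q\<^sup>2)"
  define R where "R = qpochhammer_inf q (q\<^sup>2)"
  define e where "e N = (\<Prod>i<N. 1 - (q\<^sup>2) ^ Suc i)" for N
  define r where "r N = (\<Prod>i<N. 1 - q ^ (2 * i + 1))" for N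
  have E: "e \<longlonglongrightarrow> E" "E $ 0 = 1"
    using qpochhammer_inf_limit[of "q\<^sup>2" "q\<^sup>2"] by (simp_all add: e_def[abs_def] E_def)
  have R: "r \<longlonglongrightarrow> R"
    using qpochhammer_inf_limit[of q "q\<^sup>2"]
    by (simp add: r_def[abs_def] R_def power_mult[symmetric])
  have shift: "(\<lambda>N. e (N + k)) \<longlonglongrightarrow> E" "(\<lambda>N. e (N - k)) \<longlonglongrightarrow> E" "(\<lambda>N. e (2 * N)) \<longlonglongrightarrow> E"
  proof -
    show "(\<lambda>N. e (N + k)) \<longlonglongrightarrow> E"
      using E(1) by (rule LIMSEQ_ignore_initial_segment)
    \<comment> \<open>The truncated values for \<open>N < k\<close> do not affect the limit:
      shifting by \<open>k\<close> restores \<open>e\<close>.\<close>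
    show "(\<lambda>N. e (N - k)) \<longlonglongrightarrow> E"
      using E(1) by (intro LIMSEQ_offset[of "\<lambda>N. e (N - k)" k]) simp
    have "strict_mono (\<lambda>N::nat. 2 * N)"
      by (rule strict_monoI) simp
    then show "(\<lambda>N. e (2 * N)) \<longlonglongrightarrow> E"
      using LIMSEQ_subseq_LIMSEQ[OF E(1)] by (simp add: o_def)
  qed
  have fin: "binomial_transform N k * (r N * r N) * (e (N + k) * e (N - k)) = q ^ k\<^sup>2 * e (2 * N)"
    if "k \<le> N" for N
  proof -
    have "gauss_binomial (q\<^sup>2) ((N + k) + (N - k)) (N + k) * e (N + k) * e (N - k) = e ((N + k) + (N - k))"
      unfolding e_def by (rule gauss_binomial_prod)
    then have g: "gauss_binomial (q\<^sup>2) (2 * N) (N + k) * e (N + k) * e (N - k) = e (2 * N)"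
      using that by (simp add: mult_2)
    have "binomial_transform N k * (r N * r N) = q ^ k\<^sup>2 * gauss_binomial (q\<^sup>2) (2 * N) (N + k)"
      using binomial_transform_eq_gauss_binomial[of N k] by (simp add: r_def power2_eq_square)
    then show ?thesis using g by (simp add: mult.assoc)
  qed
  have "(\<lambda>N. binomial_transform N k * (r N * r N) * (e (N + k) * e (N - k))) \<longlonglongrightarrow> S * (R * R) * (E * E)"
    unfolding S_def by (intro tendsto_mult_fps binomial_transform_limit R shift)
  moreover have "(\<lambda>N. binomial_transform N k * (r N * r N) * (e (N + k) * e (N - k))) \<longlonglongrightarrow> q ^ k\<^sup>2 * E"
  proof (rule Lim_transform_eventually)
    show "(\<lambda>N. q ^ k\<^sup>2 * e (2 * N)) \<longlonglongrightarrow> q ^ k\<^sup>2 * E"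
      by (intro tendsto_mult_fps tendsto_const shift)
    show "\<forall>\<^sub>F N in sequentially. q ^ k\<^sup>2 * e (2 * N) =
        binomial_transform N k * (r N * r N) * (e (N + k) * e (N - k))"
      unfolding eventually_sequentially using fin[symmetric] by blast
  qed
  ultimately have "S * (R * R) * (E * E) = q ^ k\<^sup>2 * E"
    by (rule LIMSEQ_unique)
  then have "(S * (E * R\<^sup>2)) * E = q ^ k\<^sup>2 * E"
    by (simp add: power2_eq_square mult_ac)
  moreover have "E \<noteq> 0" using E(2) by auto
  ultimately show ?thesis unfolding S_def E_def R_def by simp
qed

section \<open>Deduction of both statements in Laurent series\<close>

theorem theorem1p3:
  shows "(\<forall>k::nat. \<exists>R \<in> q_bigO (2 * k + 1).
            fls_X powi (- int (k\<^sup>2)) * fps_to_fls (MacMahon_C k) =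
              1 / fps_to_fls (qpochhammer_inf (q\<^sup>2) (q\<^sup>2) * (qpochhammer_inf q (q\<^sup>2))\<^sup>2)
              + fps_to_fls R)
       \<and> (\<forall>k::nat.
            1 / fps_to_fls (qpochhammer_inf (q\<^sup>2) (q\<^sup>2) * (qpochhammer_inf q (q\<^sup>2))\<^sup>2) =
              fls_X powi (- int (k\<^sup>2)) *
              fps_to_fls (\<Sum>\<^sub>\<infinity>m \<in> {k..}. of_nat ((2 * m) choose (m + k)) * MacMahon_C m))"
proof -
  define P where "P = qpochhammer_inf (q\<^sup>2) (q\<^sup>2) * (qpochhammer_inf q (q\<^sup>2))\<^sup>2"
  define S where "S k = (\<Sum>\<^sub>\<infinity>m \<in> {k..}. of_nat ((2 * m) choose (m + k)) * MacMahon_C m)" for k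
  have SP: "S k * P = q ^ k\<^sup>2" for k
    unfolding S_def P_def by (rule binomial_sum_MacMahon_C)
  have "P \<noteq> 0" using SP[of 0] by auto
  have inv: "fls_X powi (- int n) * fps_to_fls (q ^ n) = (1 :: rat fls)" for n
    by (simp add: fps_to_fls_power power_int_minus)
  have main: "1 / fps_to_fls P = fls_X powi (- int (k\<^sup>2)) * fps_to_fls (S k)" for k
  proof -
    have "fls_X powi (- int (k\<^sup>2)) * fps_to_fls (S k) * fps_to_fls P = 1"
      unfolding mult.assoc fls_times_fps_to_fls[symmetric] SP by (rule inv)
    then show ?thesis using \<open>P \<noteq> 0\<close> by (simp add: field_simps)
  qed
  have "\<exists>R \<in> q_bigO (2 * k + 1).
      fls_X powi (- int (k\<^sup>2)) * fps_to_fls (MacMahon_C k) = 1 / fps_to_fls P + fps_to_fls R" for k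
  proof -
    \<comment> \<open>The term m = k of \<open>S k\<close> is C_k itself, as binom(2k, 2k) = 1, and
      all later terms are divisible by q^((k+1)^2).\<close>
    have vanish: "(MacMahon_C k - S k) $ n = 0" if "n < (k + 1)\<^sup>2" for n
    proof -
      \<comment> \<open>The upper limit \<open>n + k\<close> is at least \<open>n\<close>, as the
        coefficient formula demands, and keeps the index \<open>k\<close> in range.\<close>
      have "S k $ n = (\<Sum>m = k..n + k. of_nat ((2 * m) choose (m + k)) * MacMahon_C m $ n)"
        unfolding S_def by (rule binomial_sum_MacMahon_C_nth) simp
      also have "\<dots> = (\<Sum>m \<in> {k}. of_nat ((2 * m) choose (m + k)) * MacMahon_C m $ n)"
      proof (rule sum.mono_neutral_right)
        show "\<forall>m \<in> {k..n + k} - {k}. of_nat (2 * m choose (m + k)) * MacMahon_C m $ n = 0"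
        proof
          fix m assume "m \<in> {k..n + k} - {k}"
          then have "(k + 1)\<^sup>2 \<le> m\<^sup>2" by (intro power_mono) auto
          then show "of_nat (2 * m choose (m + k)) * MacMahon_C m $ n = 0"
            using MacMahon_C_nth_eq_0[of n m] less_le_trans[OF that] by simp
        qed
      qed auto
      finally show ?thesis by (simp add: mult_2)
    qed
    define R where "R = fps_shift (k\<^sup>2) (MacMahon_C k - S k)"
    have "MacMahon_C k - S k = q ^ k\<^sup>2 * R"
    proof (rule fps_ext)
      fix n
      show "(MacMahon_C k - S k) $ n = (q ^ k\<^sup>2 * R) $ n"
        using vanish[of n] by (auto simp: R_def fps_X_power_mult_nth power2_eq_square)
    qed
    then have "MacMahon_C k = S k + q ^ k\<^sup>2 * R"
      by (simp add: algebra_simps)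
    then have "fls_X powi (- int (k\<^sup>2)) * fps_to_fls (MacMahon_C k) =
        fls_X powi (- int (k\<^sup>2)) * fps_to_fls (S k)
        + (fls_X powi (- int (k\<^sup>2)) * fps_to_fls (q ^ k\<^sup>2)) * fps_to_fls R"
      by (simp add: fls_times_fps_to_fls distrib_left mult.assoc)
    then have "fls_X powi (- int (k\<^sup>2)) * fps_to_fls (MacMahon_C k) = 1 / fps_to_fls P + fps_to_fls R"
      unfolding inv main[of k] by simp
    \<comment> \<open>After division by q^(k^2) the order is at least (k+1)^2 - k^2 = 2k +
      1.\<close>
    moreover have "R \<in> q_bigO (2 * k + 1)"
      unfolding q_bigO_def
    proof safe
      fix n assume "R $ n \<noteq> 0"
      then have "\<not> n + k\<^sup>2 < (k + 1)\<^sup>2" using vanish by (auto simp: R_def)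
      then show "2 * k + 1 \<le> n" by (simp add: power2_eq_square)
    qed
    ultimately show ?thesis by blast
  qed
  then show ?thesis using main unfolding P_def S_def by blast
qed

end
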